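(* Consider the nonlinear system $x_{k+1}=\varphi_k(x_k,w_k)$, $y_{k+1}=\gamma_{k+1}(x_{k+1})+v_{k+1}$ described in the context. Suppose that $y_{1:k+1}=(y_1,y_2,\dots,y_{k+1})$, the operator $A_{k+1}$, and the probability density function $p_{\beta_{k+1}}(\beta_{k+1})$ of $\beta_{k+1}=v_{1:k+1}A_{k+1}$ are known. Let $\gamma_{1:k+1}(x_{1:k+1})=(\gamma_1(x_1),\gamma_2(x_2),\dots,\gamma_{k+1}(x_{k+1}))$ and $z_{k+1}=y_{1:k+1}A_{k+1}$. Then the conditional probability density function of $x_{k+1}$ given $z_{k+1}$ can be expressed as $$p_{x_{k+1}|z_{k+1}}(x_{k+1}\mid z_{k+1})=\frac{\displaystyle\int_{-\infty}^{+\infty} p_{x_0}(x_0)\,p_{w_{0:k}}(w_{0:k})\,p_{\beta_{k+1}}\big(z_{k+1}-\gamma_{1:k+1}(x_{1:k+1})A_{k+1}\big)\,\delta\big(x_{k+1}-\varphi_k(x_k,w_k)\big)\,dx_0\,dw_{0:k}}{\displaystyle\int_{-\infty}^{+\infty} p_{x_0}(x_0)\,p_{w_{0:k}}(w_{0:k})\,p_{\beta_{k+1}}\big(z_{k+1}-\gamma_{1:k+1}(x_{1:k+1})A_{k+1}\big)\,dx_0\,dw_{0:k}}.$$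
   Context: Here $x_k$ is the (vector) state at time $k$, $y_{k+1}$ the (vector) measurement at time $k+1$, $\varphi_k$ the nonlinear state transition function, $\gamma_{k+1}$ the nonlinear measurement function, and $w_k$, $v_{k+1}$ are zero mean process noise and measurement noise. The initial state $x_0$ has probability density function $p_{x_0}$; the joint probability density functions of $w_{0:k}=(w_0,w_1,\dots,w_k)$ and $v_{1:k+1}=(v_1,v_2,\dots,v_{k+1})$ are $p_{w_{0:k}}$ and $p_{v_{1:k+1}}$. The noise is not assumed to be Gaussian white noise. The tuples $y_{1:k+1}$, $v_{1:k+1}$, $\gamma_{1:k+1}(x_{1:k+1})$ are regarded as matrices whose columns are the listed vectors. $A_{k+1}$ is an operator, acting by multiplication on the right, that extracts from $y_{1:k+1}$ the measurements that are key for estimating $x_{k+1}$; for example, the $0$-$1$ matrix whose two columns are the last two standard basis vectors gives $z_{k+1}=(y_k,y_{k+1})$. The quantity $\beta_{k+1}=v_{1:k+1}A_{k+1}$ is the measurement error of $z_{k+1}$. The integrals are over all values of $(x_0,w_{0:k})$. The states appearing in $\gamma_{1:k+1}(x_{1:k+1})$ and in $\varphi_k(x_k,w_k)$ are the functions of $(x_0,w_{0:k})$ determined by the recursion $x_{i+1}=\varphi_i(x_i,w_i)$, while the $x_{k+1}$ standing alone in $\delta(x_{k+1}-\cdot)$ is the argument of the conditional density. $\delta$ of a vector is the product of the Dirac functions of its components.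
   Formalization: The initial state, the process noise tuple and the measurement noise tuple are additionally assumed mutually independent, without which the formula fails; the transition and measurement functions are assumed Borel measurable. *)

theory Defs
  imports "HOL-Probability.Probability"
begin

text \<open>
  The state after \<open>i\<close> steps as a function of the initial state \<open>a\<close> and of the noise values
  \<open>u 0, ..., u (i - 1)\<close>.
\<close>

primrec state :: "(nat \<Rightarrow> 'x \<Rightarrow> 'w \<Rightarrow> 'x) \<Rightarrow> 'x \<Rightarrow> (nat \<Rightarrow> 'w) \<Rightarrow> nat \<Rightarrow> 'x" where
  "state \<phi> a u 0 = a"
| "state \<phi> a u (Suc i) = \<phi> i (state \<phi> a u i) (u i)"

text \<open>
  \<open>columns_mult n Y A\<close> is the matrix product of the \<open>m \<times> n\<close> matrix with columns
  \<open>Y 1, ..., Y n\<close> and the \<open>n \<times> l\<close> matrix with rows \<open>A 1, ..., A n\<close>. The number \<open>n\<close> of columns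
  is the number of elapsed time steps, so it is a number here and not a type.
\<close>

definition columns_mult :: "nat \<Rightarrow> (nat \<Rightarrow> real^'m) \<Rightarrow> (nat \<Rightarrow> real^'l) \<Rightarrow> real^'l^'m" where
  "columns_mult n Y A = (\<chi> r c. \<Sum>i = 1..n. Y i $ r * A i $ c)"

text \<open>Mutual independence of three random variables that take values in different types.\<close>

definition indep_triple ::
  "'a measure \<Rightarrow> 'b measure \<Rightarrow> ('a \<Rightarrow> 'b) \<Rightarrow> 'c measure \<Rightarrow> ('a \<Rightarrow> 'c) \<Rightarrow> 'd measure \<Rightarrow> ('a \<Rightarrow> 'd) \<Rightarrow> bool"
where
  "indep_triple M N1 X1 N2 X2 N3 X3 \<longleftrightarrow>
    X1 \<in> measurable M N1 \<and> X2 \<in> measurable M N2 \<and> X3 \<in> measurable M N3 \<and>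
    prob_space.indep_sets M
      (\<lambda>j. [{X1 -` B \<inter> space M | B. B \<in> sets N1},
            {X2 -` B \<inter> space M | B. B \<in> sets N2},
            {X3 -` B \<inter> space M | B. B \<in> sets N3}] ! j) {..<3::nat}"

text \<open>
  A nonnegative generalized function of \<open>x\<close> is represented by a Borel measure: an ordinary
  function \<open>f\<close> by \<open>density lborel f\<close>, and \<open>\<delta>(x - a)\<close>, the product over the components \<open>i\<close> of the
  one-dimensional \<open>\<delta>(x\<^sub>i - a\<^sub>i)\<close>, by the product of the point masses at the \<open>a\<^sub>i\<close>.
\<close>

definition dirac :: "real^'n \<Rightarrow> (real^'n) measure" where
  "dirac a = distr (\<Pi>\<^sub>M i\<in>UNIV. return borel (a $ i)) borel (\<lambda>f. \<chi> i. f i)"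

lemma dirac_eq_return: "dirac a = return borel a"
proof -
  have "(\<lambda>f. \<chi> i. f i) \<in> borel_measurable (\<Pi>\<^sub>M i\<in>(UNIV::'a set). (borel :: real measure))"
  proof (subst borel_measurable_euclidean_space, intro ballI)
    fix b :: "real^'a"
    assume "b \<in> Basis"
    then obtain j where "b = axis j 1"
      by (auto simp: Basis_vec_def)
    then show "(\<lambda>f. (\<chi> i. f i) \<bullet> b) \<in> borel_measurable (\<Pi>\<^sub>M i\<in>(UNIV::'a set). (borel :: real measure))"
      by (simp add: inner_axis)
  qed
  then show ?thesis
    unfolding dirac_def by (subst PiM_return) (simp_all add: distr_return space_PiM restrict_UNIV)
qed

text \<open>
  \<open>dirac_integral \<mu> F g\<close> is the generalized function \<open>\<integral> F(u) \<delta>(x - g(u)) d\<mu>(u)\<close> of \<open>x\<close>: its integral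
  over a Borel set \<open>B\<close> is obtained by integrating \<open>\<delta>(x - g(u))\<close> over \<open>B\<close> under the integral sign.
\<close>

definition dirac_integral ::
  "'u measure \<Rightarrow> ('u \<Rightarrow> ennreal) \<Rightarrow> ('u \<Rightarrow> real^'n) \<Rightarrow> (real^'n) measure" where
  "dirac_integral \<mu> F g =
    measure_of UNIV (sets borel) (\<lambda>B. \<integral>\<^sup>+ u. F u * emeasure (dirac (g u)) B \<partial>\<mu>)"

text \<open>
  \<open>q z\<close> is the conditional density \<open>p(\<cdot> | z)\<close> of \<open>X\<close> given \<open>Z = z\<close> as a generalized function, so that
  \<open>p(x, z) = p(x | z) p(z)\<close>. It exists even if the law of \<open>X\<close> is not absolutely continuous.
\<close>

definition generalized_conditional_density ::
  "'a measure \<Rightarrow> ('a \<Rightarrow> 'b::euclidean_space) \<Rightarrow> ('a \<Rightarrow> 'c::euclidean_space) \<Rightarrow> ('c \<Rightarrow> 'b measure) \<Rightarrow> bool"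
where
  "generalized_conditional_density M X Z q \<longleftrightarrow>
    q \<in> measurable borel (subprob_algebra borel) \<and>
    (AE z in distr M borel Z. prob_space (q z)) \<and>
    (\<forall>B\<in>sets borel. \<forall>C\<in>sets borel.
      emeasure M {\<omega>\<in>space M. X \<omega> \<in> B \<and> Z \<omega> \<in> C} = (\<integral>\<^sup>+ z\<in>C. emeasure (q z) B \<partial>distr M borel Z))"

text \<open>The ordinary conditional density \<open>p(x | z) = p(x, z) / p(z)\<close>.\<close>

definition conditional_density ::
  "'a measure \<Rightarrow> ('a \<Rightarrow> 'b::euclidean_space) \<Rightarrow> ('a \<Rightarrow> 'c::euclidean_space) \<Rightarrow> ('b \<Rightarrow> 'c \<Rightarrow> ennreal) \<Rightarrow> bool"
where
  "conditional_density M X Z p \<longleftrightarrow>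
    (\<exists>p\<^sub>X\<^sub>Z p\<^sub>Z.
      distributed M (lborel \<Otimes>\<^sub>M lborel) (\<lambda>\<omega>. (X \<omega>, Z \<omega>)) p\<^sub>X\<^sub>Z \<and>
      distributed M lborel Z p\<^sub>Z \<and>
      (\<forall>x z. p x z = p\<^sub>X\<^sub>Z (x, z) / p\<^sub>Z z))"

end

theory Submission
  imports Defs
begin

text \<open>
  Unrolling both recursions turns \<open>x (k + 1)\<close> into \<open>g S\<close> and \<open>z\<close> into a signal plus independent
  noise, \<open>h S + \<beta>\<close>, where \<open>S = (x 0, w 0, ..., w k)\<close> has a density \<open>f\<close> and \<open>\<beta>\<close> the density \<open>p_\<beta>\<close>.
  By Fubini and translation invariance, \<open>(S, z)\<close> has the density \<open>f s * p_\<beta> (\<zeta> - h s)\<close>. Integrating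
  it in \<open>s\<close> against \<open>\<delta>(x - g s)\<close> means pushing it forward along \<open>g\<close>; this disintegrates the joint law
  of \<open>x (k + 1)\<close> and \<open>z\<close> over Lebesgue measure in \<open>\<zeta>\<close>, and normalizing gives the conditional density.
  Such a disintegration is unique almost everywhere, because finite Borel measures are determined by
  their values on a countable generator; this identifies every ordinary conditional density.
\<close>

section \<open>Disintegration of a joint law over Lebesgue measure, and its uniqueness\<close>

lemma distr_borel_lborel: "distr M borel Z = distr M lborel Z"
  by (rule distr_cong) simp_all

text \<open>\<open>K \<zeta>\<close> stands for the unnormalized p(x, \<zeta>) as a generalized
  function of x. The reference measure is Lebesgue measure and not the law of \<open>Z\<close>, so
  masses may exceed 1; hence measurability is demanded set by set and not through
  \<open>subprob_algebra\<close>.\<close>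

definition joint_kernel ::
  "'a measure \<Rightarrow> ('a \<Rightarrow> 'b::topological_space) \<Rightarrow> ('a \<Rightarrow> 'c::euclidean_space) \<Rightarrow> ('c \<Rightarrow> 'b measure) \<Rightarrow> bool"
where
  "joint_kernel M X Z K \<longleftrightarrow>
    (\<forall>\<zeta>. sets (K \<zeta>) = sets borel) \<and>
    (\<forall>B\<in>sets borel. (\<lambda>\<zeta>. emeasure (K \<zeta>) B) \<in> borel_measurable borel) \<and>
    (\<forall>B\<in>sets borel. \<forall>C\<in>sets borel.
      emeasure M {\<omega>\<in>space M. X \<omega> \<in> B \<and> Z \<omega> \<in> C} = (\<integral>\<^sup>+\<zeta>\<in>C. emeasure (K \<zeta>) B \<partial>lborel))"

lemma
  assumes "joint_kernel M X Z K"
  shows joint_kernel_sets: "sets (K \<zeta>) = sets borel"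
    and joint_kernel_space: "space (K \<zeta>) = UNIV"
    and joint_kernel_measurable: "B \<in> sets borel \<Longrightarrow> (\<lambda>\<zeta>. emeasure (K \<zeta>) B) \<in> borel_measurable borel"
    and joint_kernel_emeasure: "B \<in> sets borel \<Longrightarrow> C \<in> sets borel \<Longrightarrow>
      emeasure M {\<omega>\<in>space M. X \<omega> \<in> B \<and> Z \<omega> \<in> C} = (\<integral>\<^sup>+\<zeta>\<in>C. emeasure (K \<zeta>) B \<partial>lborel)"
proof -
  show sets: "sets (K \<zeta>) = sets borel"
    using assms by (simp add: joint_kernel_def)
  show "space (K \<zeta>) = UNIV"
    using sets_eq_imp_space_eq[OF sets] by simp
qed (use assms in \<open>simp_all add: joint_kernel_def\<close>)

text \<open>Closing a countable basis under finite intersections keeps it countable; the empty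
  intersection supplies \<open>UNIV\<close>.\<close>

lemma borel_countable_generator:
  obtains E :: "'b::second_countable_topology set set"
  where "countable E" "Int_stable E" "UNIV \<in> E" "sets borel = sigma_sets UNIV E"
proof -
  obtain B :: "'b set set" where B: "countable B" "topological_basis B"
    using ex_countable_basis by auto
  define E where "E = Inter ` {F. finite F \<and> F \<subseteq> B}"
  have "countable E"
    unfolding E_def by (intro countable_image countable_Collect_finite_subset B)
  moreover have "Int_stable E"
  proof (rule Int_stableI)
    fix a b assume "a \<in> E" "b \<in> E"
    then obtain F G where "F \<subseteq> B" "finite F" "a = \<Inter>F" "G \<subseteq> B" "finite G" "b = \<Inter>G"
      unfolding E_def by auto
    then show "a \<inter> b \<in> E"
      unfolding E_def by (intro image_eqI[where x = "F \<union> G"]) auto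
  qed
  moreover have "UNIV \<in> E"
    unfolding E_def by (intro image_eqI[where x = "{}"]) auto
  moreover have "sets (borel :: 'b measure) = sigma_sets UNIV E"
  proof
    have "B \<subseteq> E"
    proof
      fix b assume "b \<in> B" then show "b \<in> E"
        unfolding E_def by (intro image_eqI[where x = "{b}"]) auto
    qed
    then have "sigma_sets UNIV B \<subseteq> sigma_sets UNIV E"
      by (rule sigma_sets_mono')
    then show "sets borel \<subseteq> sigma_sets UNIV E"
      by (simp add: borel_eq_countable_basis[OF B])
    have "open b" if "b \<in> E" for b
      using that topological_basis_open[OF B(2)] unfolding E_def by auto
    then have "E \<subseteq> sets borel" by auto
    then show "sigma_sets UNIV E \<subseteq> sets borel"
      using sets.sigma_sets_subset[of E borel] by simp
  qed
  ultimately show thesis ..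
qed

text \<open>For a single set \<open>B\<close> both kernels are densities of the same finite measure,
  hence equal almost everywhere. The exceptional null set depends on \<open>B\<close>, so only
  countably many sets can be treated at once; a countable generator is enough.\<close>

lemma joint_kernel_unique:
  fixes X :: "'a \<Rightarrow> 'b::second_countable_topology"
  assumes M: "prob_space M" and K: "joint_kernel M X Z K" and L: "joint_kernel M X Z L"
  shows "AE \<zeta> in lborel. K \<zeta> = L \<zeta>"
proof -
  interpret prob_space M by fact
  obtain E :: "'b set set"
    where E: "countable E" "Int_stable E" "UNIV \<in> E" "sets borel = sigma_sets UNIV E"
    by (rule borel_countable_generator)
  have mass: "(\<integral>\<^sup>+\<zeta>. emeasure (K \<zeta>) B \<partial>lborel) \<noteq> \<infinity>" if "B \<in> sets borel" for B
  proof -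
    have "(\<integral>\<^sup>+\<zeta>. emeasure (K \<zeta>) B \<partial>lborel) = emeasure M {\<omega>\<in>space M. X \<omega> \<in> B \<and> Z \<omega> \<in> UNIV}"
      using joint_kernel_emeasure[OF K that, of UNIV] by simp
    then show ?thesis by simp
  qed
  have "AE \<zeta> in lborel. emeasure (K \<zeta>) B = emeasure (L \<zeta>) B" if B: "B \<in> sets borel" for B
  proof -
    have [measurable]: "(\<lambda>\<zeta>. emeasure (K \<zeta>) B) \<in> borel_measurable borel"
      "(\<lambda>\<zeta>. emeasure (L \<zeta>) B) \<in> borel_measurable borel"
      using B by (rule joint_kernel_measurable[OF K] joint_kernel_measurable[OF L])+
    \<comment> \<open>On every \<open>C\<close> both measures equal the probability that
      \<open>X\<close> lies in \<open>B\<close> and \<open>Z\<close> in \<open>C\<close>.\<close>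
    have "density lborel (\<lambda>\<zeta>. emeasure (K \<zeta>) B) = density lborel (\<lambda>\<zeta>. emeasure (L \<zeta>) B)"
      by (intro measure_eqI)
         (simp_all add: emeasure_density flip: joint_kernel_emeasure[OF K B] joint_kernel_emeasure[OF L B])
    then show ?thesis
      by (subst (asm) finite_density_unique) (use mass[OF B] in auto)
  qed
  then have "AE \<zeta> in lborel. \<forall>B\<in>E. emeasure (K \<zeta>) B = emeasure (L \<zeta>) B"
    using E by (auto simp: AE_ball_countable intro: sigma_sets.Basic)
  \<comment> \<open>Agreement on a generator determines a measure only with a cover by generator
    sets of finite measure; \<open>UNIV\<close> is such a cover where the mass is finite.\<close>
  moreover have "AE \<zeta> in lborel. emeasure (K \<zeta>) UNIV \<noteq> \<infinity>"
    using mass[of UNIV] by (intro nn_integral_PInf_AE) (auto intro: joint_kernel_measurable[OF K])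
  ultimately show ?thesis
  proof eventually_elim
    fix \<zeta>
    assume "\<forall>B\<in>E. emeasure (K \<zeta>) B = emeasure (L \<zeta>) B" "emeasure (K \<zeta>) UNIV \<noteq> \<infinity>"
    then show "K \<zeta> = L \<zeta>"
      using E joint_kernel_sets[OF K, of \<zeta>] joint_kernel_sets[OF L, of \<zeta>]
      by (intro measure_eqI_generator_eq[where E = E and \<Omega> = UNIV and A = "\<lambda>_. UNIV"]) auto
  qed
qed

section \<open>From a disintegration to conditional densities\<close>

text \<open>For \<open>B = UNIV\<close> the condition on \<open>X\<close> disappears. The mass of
  \<open>K \<zeta>\<close> later becomes the denominator of the formula.\<close>

lemma joint_kernel_distributed:
  assumes K: "joint_kernel M X Z K" and Z: "Z \<in> borel_measurable M"
  shows "distributed M lborel Z (\<lambda>\<zeta>. emeasure (K \<zeta>) UNIV)"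
proof -
  have [measurable]: "(\<lambda>\<zeta>. emeasure (K \<zeta>) UNIV) \<in> borel_measurable borel"
    by (simp add: joint_kernel_measurable[OF K])
  have "distr M lborel Z = density lborel (\<lambda>\<zeta>. emeasure (K \<zeta>) UNIV)"
  proof (rule measure_eqI)
    fix C assume "C \<in> sets (distr M lborel Z)"
    then have C: "C \<in> sets borel" by simp
    have "emeasure (distr M lborel Z) C = emeasure M {\<omega>\<in>space M. X \<omega> \<in> UNIV \<and> Z \<omega> \<in> C}"
      using C Z by (simp add: emeasure_distr vimage_def Int_def conj_commute)
    also have "\<dots> = (\<integral>\<^sup>+\<zeta>\<in>C. emeasure (K \<zeta>) UNIV \<partial>lborel)"
      using C by (intro joint_kernel_emeasure[OF K]) auto
    finally show "emeasure (distr M lborel Z) C = emeasure (density lborel (\<lambda>\<zeta>. emeasure (K \<zeta>) UNIV)) C"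
      using C by (simp add: emeasure_density)
  qed simp
  with Z show ?thesis by (simp add: distributed_def)
qed

text \<open>Integrating against the law of \<open>Z\<close> multiplies by its density, the mass of
  \<open>K \<zeta>\<close>, and this cancels the normalizing factor where the mass is positive and
  finite. Where the mass is 0, both \<open>K \<zeta>\<close> and the density vanish; where it is
  infinite, the points form a Lebesgue null set.\<close>

lemma generalized_conditional_density_joint_kernel:
  assumes M: "prob_space M" and K: "joint_kernel M X Z K" and Z: "Z \<in> borel_measurable M"
  shows "generalized_conditional_density M X Z
    (\<lambda>\<zeta>. scale_measure (inverse (emeasure (K \<zeta>) UNIV)) (K \<zeta>))"
proof -
  interpret prob_space M by fact
  define D where "D \<zeta> = emeasure (K \<zeta>) UNIV" for \<zeta>
  define q where "q \<zeta> = scale_measure (inverse (D \<zeta>)) (K \<zeta>)" for \<zeta>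
  note [measurable] = joint_kernel_measurable[OF K]
  have [measurable]: "D \<in> borel_measurable borel"
    unfolding D_def by measurable
  have K_le_D: "emeasure (K \<zeta>) B \<le> D \<zeta>" for \<zeta> B
    unfolding D_def using emeasure_space[of "K \<zeta>" B] by (simp add: joint_kernel_space[OF K])
  have inverse_1: "inverse d * d = 1" if "d \<noteq> 0" "d \<noteq> \<top>" for d :: ennreal
    using ennreal_divide_self[of d] that by (simp add: divide_ennreal_def less_top mult.commute)
  have inverse_le: "inverse d * d \<le> 1" for d :: ennreal
    using inverse_1[of d] by (cases "d = 0 \<or> d = \<top>") auto
  have Z_distr: "distr M borel Z = density lborel D"
    using distributed_distr_eq_density[OF joint_kernel_distributed[OF K Z]]
    by (simp add: distr_borel_lborel D_def[abs_def])
  have "(\<integral>\<^sup>+\<zeta>. D \<zeta> \<partial>lborel) \<noteq> \<infinity>"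
  proof -
    have "(\<integral>\<^sup>+\<zeta>. D \<zeta> \<partial>lborel) = emeasure (distr M borel Z) UNIV"
      unfolding Z_distr by (simp add: emeasure_density)
    also have "\<dots> = emeasure M (space M)"
      using Z by (simp add: emeasure_distr)
    finally show ?thesis by simp
  qed
  then have D_finite: "AE \<zeta> in lborel. D \<zeta> \<noteq> \<infinity>"
    by (intro nn_integral_PInf_AE) auto
  have "q \<in> measurable borel (subprob_algebra borel)"
  proof (rule measurable_subprob_algebra)
    fix \<zeta>
    show "sets (q \<zeta>) = sets borel"
      by (simp add: q_def joint_kernel_sets[OF K])
    \<comment> \<open>Where \<open>D\<close> is \<open>0\<close> or \<open>\<infinity>\<close>, \<open>q\<close> is the null measure, since \<open>inverse 0 = \<infinity>\<close>, \<open>inverse \<infinity> = 0\<close> and \<open>\<infinity> * 0 = 0\<close>.\<close>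
    show "subprob_space (q \<zeta>)"
      by (rule subprob_spaceI)
         (simp_all add: q_def space_scale_measure joint_kernel_space[OF K] inverse_le flip: D_def)
  next
    fix B :: "'b set" assume [measurable]: "B \<in> sets borel"
    show "(\<lambda>\<zeta>. emeasure (q \<zeta>) B) \<in> borel_measurable borel"
      unfolding q_def by simp
  qed
  moreover have "AE \<zeta> in distr M borel Z. prob_space (q \<zeta>)"
    unfolding Z_distr
  proof (subst AE_density)
    \<comment> \<open>Passing to the density \<open>D\<close> discards the points with
      \<open>D \<zeta> = 0\<close>, which leaves positive finite masses.\<close>
    show "AE \<zeta> in lborel. 0 < D \<zeta> \<longrightarrow> prob_space (q \<zeta>)"
      using D_finite
    proof eventually_elim
      case (elim \<zeta>)
      then show ?case
        by (auto intro!: prob_spaceI simp: q_def space_scale_measure joint_kernel_space[OF K] inverse_1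
          simp flip: D_def)
    qed
  qed simp
  moreover have "emeasure M {\<omega>\<in>space M. X \<omega> \<in> B \<and> Z \<omega> \<in> C} =
      (\<integral>\<^sup>+\<zeta>\<in>C. emeasure (q \<zeta>) B \<partial>distr M borel Z)"
    if [measurable]: "B \<in> sets borel" "C \<in> sets borel" for B C
  proof -
    have "emeasure M {\<omega>\<in>space M. X \<omega> \<in> B \<and> Z \<omega> \<in> C} = (\<integral>\<^sup>+\<zeta>\<in>C. emeasure (K \<zeta>) B \<partial>lborel)"
      by (rule joint_kernel_emeasure[OF K that])
    also have "\<dots> = (\<integral>\<^sup>+\<zeta>. D \<zeta> * (emeasure (q \<zeta>) B * indicator C \<zeta>) \<partial>lborel)"
    proof (rule nn_integral_cong_AE)
      show "AE \<zeta> in lborel. emeasure (K \<zeta>) B * indicator C \<zeta> = D \<zeta> * (emeasure (q \<zeta>) B * indicator C \<zeta>)"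
        using D_finite
      proof eventually_elim
        case (elim \<zeta>)
        \<comment> \<open>If \<open>D \<zeta> = 0\<close>, the left side is 0, and
          \<open>K_le_D\<close> makes the right side 0 as well.\<close>
        have "D \<zeta> * (inverse (D \<zeta>) * emeasure (K \<zeta>) B) = emeasure (K \<zeta>) B"
        proof (cases "D \<zeta> = 0")
          case True
          then show ?thesis using K_le_D[of \<zeta> B] by simp
        next
          case False
          then have "D \<zeta> * inverse (D \<zeta>) = 1"
            using elim inverse_1[of "D \<zeta>"] by (simp add: mult.commute)
          then show ?thesis by (simp flip: mult.assoc)
        qed
        then show ?case by (simp add: q_def mult.assoc[symmetric])
      qed
    qed
    also have "\<dots> = (\<integral>\<^sup>+\<zeta>\<in>C. emeasure (q \<zeta>) B \<partial>distr M borel Z)"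
      unfolding Z_distr by (subst nn_integral_density) (auto simp: q_def)
    finally show ?thesis .
  qed
  ultimately show ?thesis
    unfolding generalized_conditional_density_def q_def D_def by blast
qed

text \<open>Tonelli with \<zeta> as the outer variable. Slicing a joint density in this way makes it
  comparable with kernels that have no density in x.\<close>

lemma joint_kernel_density:
  fixes X :: "'a \<Rightarrow> 'b::euclidean_space"
  assumes XZ: "distributed M (lborel \<Otimes>\<^sub>M lborel) (\<lambda>\<omega>. (X \<omega>, Z \<omega>)) p"
  shows "joint_kernel M X Z (\<lambda>\<zeta>. density lborel (\<lambda>\<xi>. p (\<xi>, \<zeta>)))"
proof -
  have [measurable]: "p \<in> borel_measurable (borel \<Otimes>\<^sub>M borel)"
    using distributed_borel_measurable[OF XZ] by (simp cong: measurable_cong_sets)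
  show ?thesis
    unfolding joint_kernel_def
  proof (intro conjI allI ballI)
    fix B :: "'b set" assume [measurable]: "B \<in> sets borel"
    show "(\<lambda>\<zeta>. emeasure (density lborel (\<lambda>\<xi>. p (\<xi>, \<zeta>))) B) \<in> borel_measurable borel"
      by (simp add: emeasure_density)
  next
    fix B :: "'b set" and C :: "'c set" assume [measurable]: "B \<in> sets borel" "C \<in> sets borel"
    have "emeasure M {\<omega>\<in>space M. X \<omega> \<in> B \<and> Z \<omega> \<in> C} =
        emeasure (distr M (lborel \<Otimes>\<^sub>M lborel) (\<lambda>\<omega>. (X \<omega>, Z \<omega>))) (B \<times> C)"
      using distributed_measurable[OF XZ]
      by (subst emeasure_distr) (auto intro!: arg_cong[where f = "emeasure M"])
    also have "\<dots> = (\<integral>\<^sup>+s. p s * indicator (B \<times> C) s \<partial>(lborel \<Otimes>\<^sub>M lborel))"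
      unfolding distributed_distr_eq_density[OF XZ] by (rule emeasure_density) auto
    also have "\<dots> = (\<integral>\<^sup>+\<zeta>. \<integral>\<^sup>+\<xi>. p (\<xi>, \<zeta>) * indicator (B \<times> C) (\<xi>, \<zeta>) \<partial>lborel \<partial>lborel)"
      by (subst lborel_pair.nn_integral_snd[symmetric]) auto
    also have "\<dots> = (\<integral>\<^sup>+\<zeta>\<in>C. emeasure (density lborel (\<lambda>\<xi>. p (\<xi>, \<zeta>))) B \<partial>lborel)"
      by (intro nn_integral_cong)
         (simp add: emeasure_density indicator_times nn_integral_multc flip: mult.assoc)
    finally show "emeasure M {\<omega>\<in>space M. X \<omega> \<in> B \<and> Z \<omega> \<in> C} =
        (\<integral>\<^sup>+\<zeta>\<in>C. emeasure (density lborel (\<lambda>\<xi>. p (\<xi>, \<zeta>))) B \<partial>lborel)" .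
  qed simp
qed

text \<open>The slices of the joint density and the kernel \<open>K\<close> disintegrate the same
  law, so they coincide almost everywhere, and so do the two densities of \<open>Z\<close>. Thus the
  chosen versions of the densities affect the quotient only on a null set.\<close>

lemma conditional_density_joint_kernel:
  assumes M: "prob_space M" and K: "joint_kernel M X Z K" and p: "conditional_density M X Z p"
  shows "AE \<zeta> in distr M borel Z.
    density lborel (\<lambda>\<xi>. p \<xi> \<zeta>) = scale_measure (inverse (emeasure (K \<zeta>) UNIV)) (K \<zeta>)"
proof -
  interpret prob_space M by fact
  obtain r d where r: "distributed M (lborel \<Otimes>\<^sub>M lborel) (\<lambda>\<omega>. (X \<omega>, Z \<omega>)) r"
    and d: "distributed M lborel Z d" and p_eq: "p \<xi> \<zeta> = r (\<xi>, \<zeta>) / d \<zeta>" for \<xi> \<zeta>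
    using p unfolding conditional_density_def by blast
  have Z: "Z \<in> borel_measurable M"
    using distributed_measurable[OF d] by simp
  have [measurable]: "d \<in> borel_measurable borel"
    using distributed_borel_measurable[OF d] by simp
  have [measurable]: "r \<in> borel_measurable (borel \<Otimes>\<^sub>M borel)"
    using distributed_borel_measurable[OF r] by (simp cong: measurable_cong_sets)
  have "AE \<zeta> in lborel. density lborel (\<lambda>\<xi>. r (\<xi>, \<zeta>)) = K \<zeta>"
    by (rule joint_kernel_unique[OF M joint_kernel_density[OF r] K])
  moreover have "AE \<zeta> in lborel. d \<zeta> = emeasure (K \<zeta>) UNIV"
    by (rule distributed_unique[OF d joint_kernel_distributed[OF K Z]])
  ultimately have "AE \<zeta> in lborel.
    density lborel (\<lambda>\<xi>. p \<xi> \<zeta>) = scale_measure (inverse (emeasure (K \<zeta>) UNIV)) (K \<zeta>)"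
  proof eventually_elim
    case (elim \<zeta>)
    have "density lborel (\<lambda>\<xi>. p \<xi> \<zeta>) = scale_measure (inverse (d \<zeta>)) (density lborel (\<lambda>\<xi>. r (\<xi>, \<zeta>)))"
      by (rule measure_eqI)
         (simp_all add: p_eq divide_ennreal_def emeasure_density nn_integral_cmult mult.assoc
           mult.commute[of _ "inverse (d \<zeta>)"])
    with elim show ?case by simp
  qed
  \<comment> \<open>A Lebesgue null set is null for the law of \<open>Z\<close>, which has the
    density \<open>d\<close>.\<close>
  then have "AE \<zeta> in density lborel d.
    density lborel (\<lambda>\<xi>. p \<xi> \<zeta>) = scale_measure (inverse (emeasure (K \<zeta>) UNIV)) (K \<zeta>)"
    by (subst AE_density) (auto elim: eventually_mono)
  then show ?thesis
    unfolding distr_borel_lborel distributed_distr_eq_density[OF d] .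
qed

section \<open>Independence and product laws\<close>

text \<open>Independence of intersection-stable families extends to the \<sigma>-algebras that they
  generate. The generator \<open>E\<close> is there for an \<open>X\<close> that is itself a pair,
  where the product formula is directly available only on rectangles.\<close>

lemma (in prob_space) pair_distr_eqI_generator:
  assumes X: "random_variable S X" and Y: "random_variable T Y"
    and S: "sets S = sigma_sets (space S) E" and E: "Int_stable E" "E \<subseteq> Pow (space S)"
    and indep: "\<And>A B. A \<in> E \<Longrightarrow> B \<in> sets T \<Longrightarrow>
      prob ((X -` A \<inter> space M) \<inter> (Y -` B \<inter> space M)) = prob (X -` A \<inter> space M) * prob (Y -` B \<inter> space M)"
  shows "distr M S X \<Otimes>\<^sub>M distr M T Y = distr M (S \<Otimes>\<^sub>M T) (\<lambda>\<omega>. (X \<omega>, Y \<omega>))"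
proof -
  note [measurable] = X Y
  let ?E = "{X -` A \<inter> space M | A. A \<in> E}" and ?T = "{Y -` B \<inter> space M | B. B \<in> sets T}"
  have "Int_stable ?E"
  proof (rule Int_stableI)
    fix a b assume "a \<in> ?E" "b \<in> ?E"
    then obtain A B where "A \<in> E" "B \<in> E" "a = X -` A \<inter> space M" "b = X -` B \<inter> space M"
      by blast
    moreover from this have "A \<inter> B \<in> E"
      using E(1) by (auto simp: Int_stable_def)
    ultimately show "a \<inter> b \<in> ?E"
      by (intro CollectI exI[of _ "A \<inter> B"]) auto
  qed
  moreover have "Int_stable ?T"
  proof (rule Int_stableI)
    fix a b assume "a \<in> ?T" "b \<in> ?T"
    then obtain A B where "A \<in> sets T" "B \<in> sets T" "a = Y -` A \<inter> space M" "b = Y -` B \<inter> space M"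
      by blast
    moreover from this have "A \<inter> B \<in> sets T"
      by auto
    ultimately show "a \<inter> b \<in> ?T"
      by (intro CollectI exI[of _ "A \<inter> B"]) auto
  qed
  moreover have "indep_set ?E ?T"
  proof (rule indep_setI)
    have "E \<subseteq> sets S"
      unfolding S by auto
    then show "?E \<subseteq> events"
      using measurable_sets[OF X] by auto
    show "?T \<subseteq> events"
      using measurable_sets[OF Y] by auto
  qed (auto simp: indep)
  ultimately have indep_gen: "indep_set (sigma_sets (space M) ?E) (sigma_sets (space M) ?T)"
    by (intro indep_set_sigma_sets)
  \<comment> \<open>Preimages commute with generating a \<sigma>-algebra, so every \<open>A\<close>
    in \<open>sets S\<close> is covered.\<close>
  have S_gen: "{X -` A \<inter> space M | A. A \<in> sets S} = sigma_sets (space M) ?E"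
    unfolding S by (rule sigma_sets_vimage_commute) (use measurable_space[OF X] in auto)
  have indep': "prob ((X -` A \<inter> space M) \<inter> (Y -` B \<inter> space M)) =
      prob (X -` A \<inter> space M) * prob (Y -` B \<inter> space M)" if "A \<in> sets S" "B \<in> sets T" for A B
  proof (rule indep_setD[OF indep_gen])
    show "X -` A \<inter> space M \<in> sigma_sets (space M) ?E"
      unfolding S_gen[symmetric] by (intro CollectI exI[of _ A] conjI refl that)
    show "Y -` B \<inter> space M \<in> sigma_sets (space M) ?T"
      by (intro sigma_sets.Basic CollectI exI[of _ B] conjI refl that)
  qed
  interpret X: prob_space "distr M S X"
    by (rule prob_space_distr) fact
  interpret Y: prob_space "distr M T Y"
    by (rule prob_space_distr) fact
  show ?thesis
  proof (rule pair_measure_eqI)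
    fix A B assume "A \<in> sets (distr M S X)" "B \<in> sets (distr M T Y)"
    then have [measurable]: "A \<in> sets S" "B \<in> sets T"
      by simp_all
    have "(\<lambda>\<omega>. (X \<omega>, Y \<omega>)) -` (A \<times> B) \<inter> space M = (X -` A \<inter> space M) \<inter> (Y -` B \<inter> space M)"
      by auto
    then show "emeasure (distr M S X) A * emeasure (distr M T Y) B =
        emeasure (distr M (S \<Otimes>\<^sub>M T) (\<lambda>\<omega>. (X \<omega>, Y \<omega>))) (A \<times> B)"
      by (simp add: emeasure_distr emeasure_eq_measure indep' ennreal_mult)
  qed (simp_all add: X.sigma_finite_measure_axioms Y.sigma_finite_measure_axioms cong: sets_pair_measure_cong)
qed

lemma (in prob_space) indep_tripleD:
  assumes "indep_triple M N1 X1 N2 X2 N3 X3" "A \<in> sets N1" "B \<in> sets N2" "C \<in> sets N3"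
  shows "prob ((X1 -` A \<inter> space M) \<inter> (X2 -` B \<inter> space M) \<inter> (X3 -` C \<inter> space M)) =
    prob (X1 -` A \<inter> space M) * prob (X2 -` B \<inter> space M) * prob (X3 -` C \<inter> space M)"
proof -
  \<comment> \<open>The variables take values in different types, but their preimages are all sets
    of outcomes, so a list can index them as one family.\<close>
  define F where "F j = [{X1 -` B \<inter> space M | B. B \<in> sets N1},
    {X2 -` B \<inter> space M | B. B \<in> sets N2}, {X3 -` B \<inter> space M | B. B \<in> sets N3}] ! j" for j
  define G where "G j = [X1 -` A \<inter> space M, X2 -` B \<inter> space M, X3 -` C \<inter> space M] ! j" for j
  have set3: "{..<3::nat} = {0, 1, 2}" by auto
  have "indep_sets F {..<3}"
    using assms(1) unfolding indep_triple_def F_def by simp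
  moreover have "G 0 \<in> F 0" "G 1 \<in> F 1" "G 2 \<in> F 2"
    using assms(2-) unfolding F_def G_def by (simp_all, blast+)
  then have "\<forall>j\<in>{..<3}. G j \<in> F j"
    unfolding set3 by simp
  ultimately have "prob (\<Inter>j\<in>{..<3}. G j) = (\<Prod>j\<in>{..<3}. prob (G j))"
    by (intro indep_setsD) (auto simp: set3)
  then show ?thesis
    unfolding set3 by (simp add: G_def Int_assoc mult.assoc)
qed

text \<open>Taking the whole space as third event gives independence of the first two variables. For
  the pair against the third, rectangles generate the product \<sigma>-algebra, and on them the
  triple product formula regroups.\<close>

lemma (in prob_space)
  assumes indep: "indep_triple M N1 X1 N2 X2 N3 X3"
  shows indep_triple_distr12: "distr M N1 X1 \<Otimes>\<^sub>M distr M N2 X2 =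
      distr M (N1 \<Otimes>\<^sub>M N2) (\<lambda>\<omega>. (X1 \<omega>, X2 \<omega>))"
    and indep_triple_distr12_3: "distr M (N1 \<Otimes>\<^sub>M N2) (\<lambda>\<omega>. (X1 \<omega>, X2 \<omega>)) \<Otimes>\<^sub>M distr M N3 X3 =
      distr M ((N1 \<Otimes>\<^sub>M N2) \<Otimes>\<^sub>M N3) (\<lambda>\<omega>. ((X1 \<omega>, X2 \<omega>), X3 \<omega>))"
proof -
  have X[measurable]: "random_variable N1 X1" "random_variable N2 X2" "random_variable N3 X3"
    using indep by (auto simp: indep_triple_def)
  have whole: "X3 -` space N3 \<inter> space M = space M"
    using measurable_space[OF X(3)] by auto
  have prob12: "prob ((X1 -` A \<inter> space M) \<inter> (X2 -` B \<inter> space M)) =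
    prob (X1 -` A \<inter> space M) * prob (X2 -` B \<inter> space M)" if "A \<in> sets N1" "B \<in> sets N2" for A B
    using indep_tripleD[OF indep that sets.top]
    by (simp add: whole prob_space Int_assoc)
  then show "distr M N1 X1 \<Otimes>\<^sub>M distr M N2 X2 = distr M (N1 \<Otimes>\<^sub>M N2) (\<lambda>\<omega>. (X1 \<omega>, X2 \<omega>))"
    by (intro pair_distr_eqI_generator[where E = "sets N1"])
       (auto simp: sets.sigma_sets_eq sets.Int_stable sets.space_closed)
  show "distr M (N1 \<Otimes>\<^sub>M N2) (\<lambda>\<omega>. (X1 \<omega>, X2 \<omega>)) \<Otimes>\<^sub>M distr M N3 X3 =
      distr M ((N1 \<Otimes>\<^sub>M N2) \<Otimes>\<^sub>M N3) (\<lambda>\<omega>. ((X1 \<omega>, X2 \<omega>), X3 \<omega>))"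
  proof (rule pair_distr_eqI_generator)
    show "sets (N1 \<Otimes>\<^sub>M N2) = sigma_sets (space (N1 \<Otimes>\<^sub>M N2)) {a \<times> b | a b. a \<in> sets N1 \<and> b \<in> sets N2}"
      by (simp add: sets_pair_measure space_pair_measure)
    show "{a \<times> b | a b. a \<in> sets N1 \<and> b \<in> sets N2} \<subseteq> Pow (space (N1 \<Otimes>\<^sub>M N2))"
      using pair_measure_closed by (simp add: space_pair_measure)
    fix A C assume "A \<in> {a \<times> b | a b. a \<in> sets N1 \<and> b \<in> sets N2}" and C: "C \<in> sets N3"
    then obtain a b where A: "A = a \<times> b" and ab: "a \<in> sets N1" "b \<in> sets N2"
      by blast
    have "(\<lambda>\<omega>. (X1 \<omega>, X2 \<omega>)) -` A \<inter> space M = (X1 -` a \<inter> space M) \<inter> (X2 -` b \<inter> space M)"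
      by (auto simp: A)
    then show "prob (((\<lambda>\<omega>. (X1 \<omega>, X2 \<omega>)) -` A \<inter> space M) \<inter> (X3 -` C \<inter> space M)) =
      prob ((\<lambda>\<omega>. (X1 \<omega>, X2 \<omega>)) -` A \<inter> space M) * prob (X3 -` C \<inter> space M)"
      using indep_tripleD[OF indep ab C] prob12[OF ab] by simp
  qed (auto intro: Int_stable_pair_measure_generator)
qed

lemma indep_triple_cong_sets:
  assumes "sets N1 = sets N1'" "sets N2 = sets N2'" "sets N3 = sets N3'"
  shows "indep_triple M N1 X1 N2 X2 N3 X3 \<longleftrightarrow> indep_triple M N1' X1 N2' X2 N3' X3"
  using assms by (simp add: indep_triple_def cong: measurable_cong_sets)

section \<open>Dirac integrals, matrix products and trajectories\<close>

text \<open>\<open>dirac (g u)\<close> gives \<open>B\<close> the mass 1 or 0 according to whether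
  \<open>g u\<close> lies in \<open>B\<close>, so only the integral of \<open>f\<close> over the
  preimage of \<open>B\<close> remains. In particular the set function behind
  \<open>dirac_integral\<close> is a genuine measure here.\<close>

lemma dirac_integral_eq_distr:
  assumes [measurable]: "f \<in> borel_measurable \<mu>" "g \<in> borel_measurable \<mu>"
  shows "dirac_integral \<mu> f g = distr (density \<mu> f) borel g"
proof -
  have "(\<integral>\<^sup>+u. f u * emeasure (dirac (g u)) B \<partial>\<mu>) = emeasure (density \<mu> f) (g -` B \<inter> space (density \<mu> f))"
    if [measurable]: "B \<in> sets borel" for B
    by (auto simp: emeasure_density dirac_eq_return indicator_def intro!: nn_integral_cong)
  then show ?thesis
    \<comment> \<open>\<open>distr\<close> is itself built by \<open>measure_of\<close>, so
      comparing the set functions on Borel sets suffices.\<close>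
    unfolding dirac_integral_def distr_def space_borel
    by (intro measure_of_eq) (auto simp: sets.sigma_sets_eq[of borel, simplified])
qed

lemma columns_mult_add:
  "columns_mult n (\<lambda>i. Y i + V i) A = columns_mult n Y A + columns_mult n V A"
  by (simp add: columns_mult_def vec_eq_iff distrib_right sum.distrib)

lemma columns_mult_cong:
  "(\<And>i. i \<in> {1..n} \<Longrightarrow> Y i = V i) \<Longrightarrow> columns_mult n Y A = columns_mult n V A"
  by (simp add: columns_mult_def vec_eq_iff)

lemma columns_mult_measurable:
  fixes Y :: "nat \<Rightarrow> 's \<Rightarrow> real^'m" and A :: "nat \<Rightarrow> real^'l"
  assumes "\<And>i. i \<in> {1..n} \<Longrightarrow> Y i \<in> borel_measurable N"
  shows "(\<lambda>s. columns_mult n (\<lambda>i. Y i s) A) \<in> borel_measurable N"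
proof -
  \<comment> \<open>The matrix product is a sum of outer products of a column with a row
    \<open>A i\<close>, each continuous in the column.\<close>
  have cont: "continuous_on UNIV (\<lambda>y::real^'m. (\<chi> r c. y $ r * A i $ c) :: real^'l^'m)" for i
    by (intro continuous_intros)
  have "(\<lambda>s. \<Sum>i = 1..n. (\<chi> r c. Y i s $ r * A i $ c)) \<in> borel_measurable N"
    by (intro borel_measurable_sum borel_measurable_continuous_on[OF cont] assms)
  also have "(\<lambda>s. \<Sum>i = 1..n. (\<chi> r c. Y i s $ r * A i $ c)) = (\<lambda>s. columns_mult n (\<lambda>i. Y i s) A)"
    by (simp add: columns_mult_def vec_eq_iff fun_eq_iff)
  finally show ?thesis .
qed

text \<open>The state after \<open>i\<close> steps reads only the noise coordinates below
  \<open>i\<close>, so one index set \<open>I\<close> can serve several times at once.\<close>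

lemma state_measurable:
  fixes \<phi> :: "nat \<Rightarrow> 'x::euclidean_space \<Rightarrow> 'w::euclidean_space \<Rightarrow> 'x"
  assumes \<phi>: "\<And>j. j < i \<Longrightarrow> (\<lambda>(a, b). \<phi> j a b) \<in> borel_measurable (borel \<Otimes>\<^sub>M borel)"
    and I: "{..<i} \<subseteq> I"
  shows "(\<lambda>(a, u). state \<phi> a u i) \<in> borel_measurable (lborel \<Otimes>\<^sub>M (\<Pi>\<^sub>M j\<in>I. lborel))"
  using assms
proof (induction i)
  case 0
  then show ?case by simp
next
  case (Suc i)
  let ?U = "lborel \<Otimes>\<^sub>M (\<Pi>\<^sub>M j\<in>I. lborel) :: ('x \<times> (nat \<Rightarrow> 'w)) measure"
  have "(\<lambda>(a, u). state \<phi> a u i) \<in> borel_measurable ?U"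
    by (rule Suc.IH) (use Suc.prems in auto)
  moreover have "(\<lambda>(a, u). u i) \<in> borel_measurable ?U"
    using Suc.prems(2) by auto
  ultimately have "(\<lambda>(a, u). (state \<phi> a u i, u i)) \<in> measurable ?U (borel \<Otimes>\<^sub>M borel)"
    by (simp add: case_prod_unfold)
  from measurable_compose[OF this Suc.prems(1)[of i]] show ?case
    by (simp add: case_prod_unfold)
qed

lemma state_eq_trajectory:
  assumes "\<And>j. j < i \<Longrightarrow> x (Suc j) = \<phi> j (x j) (u j)"
  shows "x i = state \<phi> (x 0) u i"
  using assms by (induction i) auto

section \<open>Disintegration for a signal with additive independent noise\<close>

lemma lborel_nn_integral_shift:
  fixes c :: "'a::euclidean_space"
  assumes [measurable]: "f \<in> borel_measurable borel"
  shows "(\<integral>\<^sup>+x. f x \<partial>lborel) = (\<integral>\<^sup>+x. f (c + x) \<partial>lborel)"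
  by (subst lborel_distr_plus[of c, symmetric]) (simp add: nn_integral_distr)

text \<open>By independence, \<open>(S, N)\<close> has the product density. For a fixed signal value
  \<open>s\<close> a translation turns the noise into the observation \<zeta>; exchanging the
  integrals then puts \<zeta> outside, and the inner integral is the mass of \<open>B\<close> under
  the pushforward along \<open>g\<close>.\<close>

lemma joint_kernel_signal_plus_noise:
  fixes X :: "'a \<Rightarrow> 'b::topological_space" and Z :: "'a \<Rightarrow> 'c::euclidean_space"
  assumes M: "prob_space M" and U: "sigma_finite_measure U"
    and S: "distributed M U S f" and N: "distributed M lborel N p"
    and indep: "distr M U S \<Otimes>\<^sub>M distr M lborel N = distr M (U \<Otimes>\<^sub>M lborel) (\<lambda>\<omega>. (S \<omega>, N \<omega>))"
    and g[measurable]: "g \<in> borel_measurable U" and h[measurable]: "h \<in> borel_measurable U"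
    and X: "\<And>\<omega>. \<omega> \<in> space M \<Longrightarrow> X \<omega> = g (S \<omega>)"
    and Z: "\<And>\<omega>. \<omega> \<in> space M \<Longrightarrow> Z \<omega> = h (S \<omega>) + N \<omega>"
  shows "joint_kernel M X Z (\<lambda>\<zeta>. distr (density U (\<lambda>s. f s * p (\<zeta> - h s))) borel g)"
proof -
  interpret prob_space M by fact
  interpret U: sigma_finite_measure U by fact
  interpret pair_sigma_finite U "lborel :: 'c measure" ..
  have [measurable]: "f \<in> borel_measurable U" "p \<in> borel_measurable borel"
    using distributed_borel_measurable[OF S] distributed_borel_measurable[OF N] by simp_all
  have kernel: "emeasure (distr (density U (\<lambda>s. f s * p (\<zeta> - h s))) borel g) B =
      (\<integral>\<^sup>+s. f s * p (\<zeta> - h s) * indicator B (g s) \<partial>U)"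
    if [measurable]: "B \<in> sets borel" for \<zeta> B
    by (subst emeasure_distr)
       (auto simp: emeasure_density indicator_def intro!: nn_integral_cong)
  have SN: "distributed M (U \<Otimes>\<^sub>M lborel) (\<lambda>\<omega>. (S \<omega>, N \<omega>)) (\<lambda>(s, b). f s * p b)"
    by (intro distributed_joint_indep' U sigma_finite_lborel S N indep)
  have [measurable]: "S \<in> measurable M U" "N \<in> borel_measurable M"
    using distributed_measurable[OF S] distributed_measurable[OF N] by simp_all
  show ?thesis
    unfolding joint_kernel_def
  proof (intro conjI allI ballI)
    fix B :: "'b set" assume [measurable]: "B \<in> sets borel"
    show "(\<lambda>\<zeta>. emeasure (distr (density U (\<lambda>s. f s * p (\<zeta> - h s))) borel g) B) \<in> borel_measurable borel"
      unfolding kernel[OF \<open>B \<in> sets borel\<close>] by measurable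
  next
    fix B :: "'b set" and C :: "'c set"
    assume B[measurable]: "B \<in> sets borel" and C[measurable]: "C \<in> sets borel"
    let ?E = "{\<omega>\<in>space M. g (S \<omega>) \<in> B \<and> h (S \<omega>) + N \<omega> \<in> C}"
    have "{\<omega>\<in>space M. X \<omega> \<in> B \<and> Z \<omega> \<in> C} = ?E"
      using X Z by auto
    moreover have "?E \<in> sets M"
      by measurable
    ultimately have "emeasure M {\<omega>\<in>space M. X \<omega> \<in> B \<and> Z \<omega> \<in> C} = (\<integral>\<^sup>+\<omega>. indicator ?E \<omega> \<partial>M)"
      by simp
    also have "\<dots> = (\<integral>\<^sup>+\<omega>. (\<lambda>(s, b). indicator B (g s) * indicator C (h s + b)) (S \<omega>, N \<omega>) \<partial>M)"
      by (intro nn_integral_cong) (auto simp: indicator_def)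
    also have "\<dots> = (\<integral>\<^sup>+t. (\<lambda>(s, b). f s * p b) t *
        (\<lambda>(s, b). indicator B (g s) * indicator C (h s + b)) t \<partial>(U \<Otimes>\<^sub>M lborel))"
      by (rule distributed_nn_integral[OF SN, symmetric]) measurable
    also have "\<dots> = (\<integral>\<^sup>+s. \<integral>\<^sup>+b. f s * p b * (indicator B (g s) * indicator C (h s + b)) \<partial>lborel \<partial>U)"
      by (subst lborel.nn_integral_fst[symmetric]) auto
    also have "\<dots> = (\<integral>\<^sup>+s. \<integral>\<^sup>+\<zeta>. f s * p (\<zeta> - h s) * (indicator B (g s) * indicator C \<zeta>) \<partial>lborel \<partial>U)"
    proof (rule nn_integral_cong)
      fix s assume "s \<in> space U"
      \<comment> \<open>The substitution \<open>\<zeta> = h s + b\<close> is made in the right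
        side.\<close>
      show "(\<integral>\<^sup>+b. f s * p b * (indicator B (g s) * indicator C (h s + b)) \<partial>lborel) =
          (\<integral>\<^sup>+\<zeta>. f s * p (\<zeta> - h s) * (indicator B (g s) * indicator C \<zeta>) \<partial>lborel)"
        by (subst (2) lborel_nn_integral_shift[of _ "h s"]) simp_all
    qed
    also have "\<dots> = (\<integral>\<^sup>+\<zeta>. \<integral>\<^sup>+s. f s * p (\<zeta> - h s) * (indicator B (g s) * indicator C \<zeta>) \<partial>U \<partial>lborel)"
      by (rule Fubini'[symmetric]) measurable
    also have "\<dots> = (\<integral>\<^sup>+\<zeta>\<in>C. emeasure (distr (density U (\<lambda>s. f s * p (\<zeta> - h s))) borel g) B \<partial>lborel)"
      unfolding kernel[OF B] mult.assoc[symmetric]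
      by (intro nn_integral_cong nn_integral_multc) measurable
    finally show "emeasure M {\<omega>\<in>space M. X \<omega> \<in> B \<and> Z \<omega> \<in> C} =
        (\<integral>\<^sup>+\<zeta>\<in>C. emeasure (distr (density U (\<lambda>s. f s * p (\<zeta> - h s))) borel g) B \<partial>lborel)" .
  qed simp
qed

section \<open>The conditional density of the state of the nonlinear system\<close>

theorem theorem4:
  fixes M :: "'a measure"
    and \<phi> :: "nat \<Rightarrow> real^'n \<Rightarrow> real^'q \<Rightarrow> real^'n"
    and \<gamma> :: "nat \<Rightarrow> real^'n \<Rightarrow> real^'m"
    and x :: "nat \<Rightarrow> 'a \<Rightarrow> real^'n"
    and y :: "nat \<Rightarrow> 'a \<Rightarrow> real^'m"
    and w :: "nat \<Rightarrow> 'a \<Rightarrow> real^'q"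
    and v :: "nat \<Rightarrow> 'a \<Rightarrow> real^'m"
    and k :: nat
    and A :: "nat \<Rightarrow> real^'l"
    and p_x0 :: "real^'n \<Rightarrow> ennreal"
    and p_w :: "(nat \<Rightarrow> real^'q) \<Rightarrow> ennreal"
    and p_v :: "(nat \<Rightarrow> real^'m) \<Rightarrow> ennreal"
    and p_\<beta> :: "real^'l^'m \<Rightarrow> ennreal"
  defines "\<beta> \<equiv> \<lambda>\<omega>. columns_mult (k + 1) (\<lambda>i. v i \<omega>) A"
    and "z \<equiv> \<lambda>\<omega>. columns_mult (k + 1) (\<lambda>i. y i \<omega>) A"
    and "U \<equiv> lborel \<Otimes>\<^sub>M (\<Pi>\<^sub>M i\<in>{0..k}. lborel)"
    and "F \<equiv> \<lambda>\<zeta> (a, u). p_x0 a * p_w u *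
           p_\<beta> (\<zeta> - columns_mult (k + 1) (\<lambda>i. \<gamma> i (state \<phi> a u i)) A)"
    and "g \<equiv> \<lambda>(a, u). \<phi> k (state \<phi> a u k) (u k)"
  defines "ratio \<equiv> \<lambda>\<zeta>. scale_measure (inverse (\<integral>\<^sup>+ s. F \<zeta> s \<partial>U)) (dirac_integral U (F \<zeta>) g)"
  assumes "prob_space M"
    and \<phi>_measurable: "\<And>i. i \<le> k \<Longrightarrow> (\<lambda>(a, b). \<phi> i a b) \<in> borel_measurable (borel \<Otimes>\<^sub>M borel)"
    and \<gamma>_measurable: "\<And>i. i \<in> {1..k+1} \<Longrightarrow> \<gamma> i \<in> borel_measurable borel"
    and state_eq: "\<And>i \<omega>. i \<le> k \<Longrightarrow> \<omega> \<in> space M \<Longrightarrow> x (i + 1) \<omega> = \<phi> i (x i \<omega>) (w i \<omega>)"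
    and measurement_eq: "\<And>i \<omega>. i \<le> k \<Longrightarrow> \<omega> \<in> space M \<Longrightarrow>
          y (i + 1) \<omega> = \<gamma> (i + 1) (x (i + 1) \<omega>) + v (i + 1) \<omega>"
    and w_zero_mean: "\<And>i. i \<le> k \<Longrightarrow> integrable M (w i) \<and> integral\<^sup>L M (w i) = 0"
    and v_zero_mean: "\<And>i. i \<in> {1..k+1} \<Longrightarrow> integrable M (v i) \<and> integral\<^sup>L M (v i) = 0"
    and x0_density: "distributed M lborel (x 0) p_x0"
    and w_density: "distributed M (\<Pi>\<^sub>M i\<in>{0..k}. lborel) (\<lambda>\<omega>. \<lambda>i\<in>{0..k}. w i \<omega>) p_w"
    and v_density: "distributed M (\<Pi>\<^sub>M i\<in>{1..k+1}. lborel) (\<lambda>\<omega>. \<lambda>i\<in>{1..k+1}. v i \<omega>) p_v"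
    and \<beta>_density: "distributed M lborel \<beta> p_\<beta>"
    and independent: "indep_triple M borel (x 0)
          (\<Pi>\<^sub>M i\<in>{0..k}. borel) (\<lambda>\<omega>. \<lambda>i\<in>{0..k}. w i \<omega>)
          (\<Pi>\<^sub>M i\<in>{1..k+1}. borel) (\<lambda>\<omega>. \<lambda>i\<in>{1..k+1}. v i \<omega>)"
  shows "generalized_conditional_density M (x (k + 1)) z ratio \<and>
    (\<forall>p. conditional_density M (x (k + 1)) z p \<longrightarrow>
      (AE \<zeta> in distr M borel z. density lborel (\<lambda>\<xi>. p \<xi> \<zeta>) = ratio \<zeta>))"
proof -
  interpret prob_space M by fact
  let ?P = "\<Pi>\<^sub>M i\<in>{0..k}. (lborel :: (real^'q) measure)"
  let ?Q = "\<Pi>\<^sub>M i\<in>{1..k+1}. (lborel :: (real^'m) measure)"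
  interpret prod: product_sigma_finite "\<lambda>_::nat. lborel :: (real^'q) measure"
    by (intro product_sigma_finite.intro sigma_finite_lborel)
  interpret P: sigma_finite_measure ?P
    by (rule prod.sigma_finite) simp
  interpret U: pair_sigma_finite "lborel :: (real^'n) measure" ?P ..
  have U_sigma_finite: "sigma_finite_measure U"
    unfolding U_def by (rule U.P.sigma_finite_measure_axioms)
  \<comment> \<open>Restricted functions, because points of a product space are
    \<open>undefined\<close> outside the index set.\<close>
  define W where "W \<omega> = (\<lambda>i\<in>{0..k}. w i \<omega>)" for \<omega>
  define V where "V \<omega> = (\<lambda>i\<in>{1..k+1}. v i \<omega>)" for \<omega>
  \<comment> \<open>\<open>S\<close> is the variable of integration, \<open>f\<close> its density,
    \<open>h\<close> the noiseless part of \<open>z\<close>, and \<open>K\<close> the numerator as a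
    measure in x.\<close>
  define S where "S \<omega> = (x 0 \<omega>, W \<omega>)" for \<omega>
  define f where "f = (\<lambda>(a, u). p_x0 a * p_w u)"
  define h where "h = (\<lambda>(a, u). columns_mult (k + 1) (\<lambda>i. \<gamma> i (state \<phi> a u i)) A)"
  define K where "K \<zeta> = distr (density U (\<lambda>s. f s * p_\<beta> (\<zeta> - h s))) borel g" for \<zeta>

  \<comment> \<open>Independence is stated over \<open>borel\<close> and the densities over
    \<open>lborel\<close>; the \<sigma>-algebras are equal.\<close>
  have "sets (\<Pi>\<^sub>M i\<in>{0..k}. (borel :: (real^'q) measure)) = sets ?P"
    and "sets (\<Pi>\<^sub>M i\<in>{1..k+1}. (borel :: (real^'m) measure)) = sets ?Q"
    by (intro sets_PiM_cong; simp)+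
  then have indep: "indep_triple M lborel (x 0) ?P W ?Q V"
    using independent unfolding W_def[abs_def] V_def[abs_def]
    by (subst indep_triple_cong_sets[where N1' = borel]) auto
  have S_density: "distributed M U S f"
    unfolding U_def S_def f_def
  proof (rule distributed_joint_indep'[OF sigma_finite_lborel P.sigma_finite_measure_axioms x0_density])
    show "distributed M ?P W p_w"
      using w_density by (simp add: W_def[abs_def])
    show "distr M lborel (x 0) \<Otimes>\<^sub>M distr M ?P W = distr M (lborel \<Otimes>\<^sub>M ?P) (\<lambda>\<omega>. (x 0 \<omega>, W \<omega>))"
      by (rule indep_triple_distr12[OF indep])
  qed
  \<comment> \<open>As a function of \<open>V\<close> alone, \<open>\<beta>\<close> inherits the
    independence of \<open>S\<close> and \<open>V\<close>.\<close>
  have \<beta>_eq: "\<beta> = (\<lambda>v. columns_mult (k + 1) v A) \<circ> V"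
    by (auto simp: \<beta>_def V_def fun_eq_iff intro: columns_mult_cong)
  have columns_measurable: "(\<lambda>v. columns_mult (k + 1) v A) \<in> measurable ?Q lborel"
    unfolding measurable_lborel1 by (rule columns_mult_measurable[where Y = "\<lambda>i v. v i"]) simp
  have S_\<beta>_indep: "distr M U S \<Otimes>\<^sub>M distr M lborel \<beta> = distr M (U \<Otimes>\<^sub>M lborel) (\<lambda>\<omega>. (S \<omega>, \<beta> \<omega>))"
  proof -
    have S_measurable: "S \<in> measurable M U" and V_measurable: "V \<in> measurable M ?Q"
      using distributed_measurable[OF S_density] distributed_measurable[OF v_density]
      unfolding V_def[abs_def] .
    interpret \<beta>: prob_space "distr M lborel \<beta>"
      by (rule prob_space_distr) (rule distributed_measurable[OF \<beta>_density])
    have \<beta>_distr: "distr (distr M ?Q V) lborel (\<lambda>v. columns_mult (k + 1) v A) = distr M lborel \<beta>"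
      unfolding \<beta>_eq by (rule distr_distr[OF columns_measurable V_measurable])
    \<comment> \<open>The law of \<open>S\<close> is written as its own image under the identity, so
      that the product of two images becomes the image of a product.\<close>
    have "distr M U S \<Otimes>\<^sub>M distr M lborel \<beta> =
        distr (distr M U S) U (\<lambda>s. s) \<Otimes>\<^sub>M distr (distr M ?Q V) lborel (\<lambda>v. columns_mult (k + 1) v A)"
      unfolding \<beta>_distr by (simp add: distr_distr[OF _ S_measurable] comp_def)
    also have "\<dots> = distr (distr M U S \<Otimes>\<^sub>M distr M ?Q V) (U \<Otimes>\<^sub>M lborel)
        (\<lambda>(s, v). (s, columns_mult (k + 1) v A))"
    proof (rule pair_measure_distr)
      show "(\<lambda>v. columns_mult (k + 1) v A) \<in> measurable (distr M ?Q V) lborel"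
        unfolding measurable_distr_eq1 by (rule columns_measurable)
      show "sigma_finite_measure (distr (distr M ?Q V) lborel (\<lambda>v. columns_mult (k + 1) v A))"
        unfolding \<beta>_distr by (rule \<beta>.sigma_finite_measure_axioms)
    qed simp
    also have "distr M U S \<Otimes>\<^sub>M distr M ?Q V = distr M (U \<Otimes>\<^sub>M ?Q) (\<lambda>\<omega>. (S \<omega>, V \<omega>))"
      unfolding U_def S_def by (rule indep_triple_distr12_3[OF indep])
    also have "distr \<dots> (U \<Otimes>\<^sub>M lborel) (\<lambda>(s, v). (s, columns_mult (k + 1) v A)) =
        distr M (U \<Otimes>\<^sub>M lborel) ((\<lambda>(s, v). (s, columns_mult (k + 1) v A)) \<circ> (\<lambda>\<omega>. (S \<omega>, V \<omega>)))"
    proof (rule distr_distr)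
      show "(\<lambda>(s, v). (s, columns_mult (k + 1) v A)) \<in> measurable (U \<Otimes>\<^sub>M ?Q) (U \<Otimes>\<^sub>M lborel)"
        unfolding case_prod_unfold
        by (intro measurable_Pair measurable_fst measurable_compose[OF measurable_snd columns_measurable])
    qed (intro measurable_Pair S_measurable V_measurable)
    also have "(\<lambda>(s, v). (s, columns_mult (k + 1) v A)) \<circ> (\<lambda>\<omega>. (S \<omega>, V \<omega>)) = (\<lambda>\<omega>. (S \<omega>, \<beta> \<omega>))"
      by (simp add: \<beta>_eq comp_def)
    finally show ?thesis .
  qed

  \<comment> \<open>Times up to \<open>k + 1\<close> read the noise coordinates 0 to
    \<open>k\<close>, exactly the index set in \<open>U\<close>.\<close>
  have state_U: "(\<lambda>(a, u). state \<phi> a u i) \<in> borel_measurable U" if "i \<le> k + 1" for i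
    unfolding U_def using that by (intro state_measurable \<phi>_measurable) auto
  \<comment> \<open>The point \<phi>_k(x_k, w_k) inside the delta is one further step of the
    recursion.\<close>
  have g_eq: "g = (\<lambda>(a, u). state \<phi> a u (k + 1))"
    by (simp add: g_def)
  have g_measurable: "g \<in> borel_measurable U"
    unfolding g_eq by (rule state_U) simp
  have h_measurable: "h \<in> borel_measurable U"
    unfolding h_def case_prod_unfold
  proof (rule columns_mult_measurable)
    fix i assume i: "i \<in> {1..k + 1}"
    then show "(\<lambda>s. \<gamma> i (state \<phi> (fst s) (snd s) i)) \<in> borel_measurable U"
      using measurable_compose[OF state_U[of i] \<gamma>_measurable[OF i]] by (simp add: case_prod_unfold)
  qed
  \<comment> \<open>\<open>W\<close> may replace the full noise sequence, since only its entries up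
    to \<open>k\<close> are read.\<close>
  have x_eq: "x i \<omega> = state \<phi> (x 0 \<omega>) (W \<omega>) i" if "i \<le> k + 1" "\<omega> \<in> space M" for i \<omega>
    using that state_eq
    by (intro state_eq_trajectory[of i "\<lambda>i. x i \<omega>"]) (simp add: W_def)
  have x_signal: "x (k + 1) \<omega> = g (S \<omega>)" if "\<omega> \<in> space M" for \<omega>
    unfolding g_eq S_def using x_eq[OF _ that, of "k + 1"] by simp
  have z_signal: "z \<omega> = h (S \<omega>) + \<beta> \<omega>" if "\<omega> \<in> space M" for \<omega>
  proof -
    \<comment> \<open>The measurement hypothesis is indexed by the preceding time, hence its use at
      \<open>i - 1\<close>, legitimate because \<open>i\<close> starts at 1.\<close>
    have "y i \<omega> = \<gamma> i (state \<phi> (x 0 \<omega>) (W \<omega>) i) + v i \<omega>" if "i \<in> {1..k + 1}" for i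
      using measurement_eq[of "i - 1" \<omega>] x_eq[of i \<omega>] \<open>\<omega> \<in> space M\<close> that by (simp add: le_diff_conv)
    then have "z \<omega> = columns_mult (k + 1) (\<lambda>i. \<gamma> i (state \<phi> (x 0 \<omega>) (W \<omega>) i) + v i \<omega>) A"
      unfolding z_def by (rule columns_mult_cong)
    \<comment> \<open>The extraction of key measurements is additive, which splits off
      \<open>\<beta>\<close>.\<close>
    then show ?thesis
      by (simp add: h_def S_def \<beta>_def columns_mult_add)
  qed

  have kernel: "joint_kernel M (x (k + 1)) z K"
    unfolding K_def
    by (rule joint_kernel_signal_plus_noise[OF \<open>prob_space M\<close> U_sigma_finite S_density \<beta>_density
          S_\<beta>_indep g_measurable h_measurable x_signal z_signal])
  have z_measurable: "z \<in> borel_measurable M"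
  proof (subst measurable_cong[OF z_signal])
    show "(\<lambda>\<omega>. h (S \<omega>) + \<beta> \<omega>) \<in> borel_measurable M"
      using measurable_compose[OF distributed_measurable[OF S_density] h_measurable]
        distributed_measurable[OF \<beta>_density] by simp
  qed
  \<comment> \<open>The numerator is the pushforward \<open>K \<zeta>\<close>; the denominator is
    its total mass, since a pushforward preserves mass.\<close>
  have "ratio = (\<lambda>\<zeta>. scale_measure (inverse (emeasure (K \<zeta>) UNIV)) (K \<zeta>))"
  proof
    fix \<zeta>
    have F_eq: "F \<zeta> = (\<lambda>s. f s * p_\<beta> (\<zeta> - h s))"
      by (auto simp: F_def f_def h_def)
    have "F \<zeta> \<in> borel_measurable U"
      using distributed_borel_measurable[OF S_density] distributed_borel_measurable[OF \<beta>_density] h_measurable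
      unfolding F_eq by simp
    then have "dirac_integral U (F \<zeta>) g = K \<zeta>" "(\<integral>\<^sup>+s. F \<zeta> s \<partial>U) = emeasure (K \<zeta>) UNIV"
      using g_measurable unfolding K_def F_eq[symmetric]
      by (simp_all add: dirac_integral_eq_distr emeasure_distr emeasure_density cong: nn_integral_cong)
    then show "ratio \<zeta> = scale_measure (inverse (emeasure (K \<zeta>) UNIV)) (K \<zeta>)"
      by (simp add: ratio_def)
  qed
  with generalized_conditional_density_joint_kernel[OF \<open>prob_space M\<close> kernel z_measurable]
    conditional_density_joint_kernel[OF \<open>prob_space M\<close> kernel]
  show ?thesis
    by simp
qed

end
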